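(* Let $n\ge 3$ and let $M_{n,1}=\{0,x_1,a_1,\dots,a_n\}$ be a set of $n+2$ distinct elements with a commutative multiplication such that $0x=0$ for all $x$, $a_1x_1=0$, and $a_ia_j=0$ for all $i\neq j$. Suppose that the subset $M_n=\{0,a_1,\dots,a_n\}$ is closed under the multiplication and is a zero-divisor semigroup with $\Gamma(M_n)\cong K_n$. Assume further that $x_1^2=x_1$. Then $M_{n,1}$ is a zero-divisor semigroup whose zero-divisor graph is $K_n+1$ (with end vertex $x_1$) if and only if the following conditions hold: (1) For all $i\ge 2$, $a_ix_1\in M_n\setminus\{a_1,0\}$, and there exists at least one $i\ge 2$ such that $a_ix_1=a_i$. (2) Whenever $a_j=a_ix_1$ with $i,j\in\{2,\dots,n\}$, $i\neq j$, then $a_jx_1=a_j$, $a_j^2=0$, and $a_i^2=0$ or $a_i^2=a_1$. (3) Whenever $a_rx_1=a_r$ with $r\ge 2$, then $a_r^2$ is equal to $0$, or to $a_r$, or to $a_j$ for some $j\in\{2,\dots,n\}$ with $j\ne r$; and if $a_rx_1=a_r$ and $a_r^2=a_j$ for some $j\in\{2,\dots,n\}$ with $j\neq r$, then $a_jx_1=a_j$ and $a_j^2=0$. (4) $a_1^2=0$ or $a_1^2=a_1$; and if $a_i^2=a_1$ for some $i\ge 2$, then $a_1^2=0$.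
   Context: All semigroups are commutative, written multiplicatively, with a zero element $0$ satisfying $0x=0$ for all $x$. An element $x$ of such a semigroup $S$ is a zero-divisor if $xy=0$ for some nonzero $y\in S$. A zero-divisor semigroup is a commutative semigroup with zero all of whose elements are zero-divisors. For a zero-divisor semigroup $S$, its zero-divisor graph $\Gamma(S)$ is the simple undirected graph with vertex set $S\setminus\{0\}$ in which distinct vertices $x\neq y$ are joined by an edge exactly when $xy=0$. $K_n$ denotes the complete graph on $n$ vertices, and $K_n+1$ denotes $K_n$ together with one end vertex, i.e. $K_n$ with one additional vertex joined to exactly one vertex of $K_n$. In $M_{n,1}$ the end vertex is $x_1$, adjacent to $a_1$. *)

theory Defs
  imports "Graph_Theory.Graph_Theory"
begin

locale comm_semigroup_with_zero =
  fixes S :: "'a set" and mul :: "'a \<Rightarrow> 'a \<Rightarrow> 'a" (infixl "\<cdot>" 70) and z :: 'a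
  assumes closed: "x \<in> S \<Longrightarrow> y \<in> S \<Longrightarrow> x \<cdot> y \<in> S"
    and assoc: "x \<in> S \<Longrightarrow> y \<in> S \<Longrightarrow> w \<in> S \<Longrightarrow> (x \<cdot> y) \<cdot> w = x \<cdot> (y \<cdot> w)"
    and commute: "x \<in> S \<Longrightarrow> y \<in> S \<Longrightarrow> x \<cdot> y = y \<cdot> x"
    and zero_closed: "z \<in> S"
    and zero_mult: "x \<in> S \<Longrightarrow> z \<cdot> x = z"

definition zero_divisor :: "'a set \<Rightarrow> ('a \<Rightarrow> 'a \<Rightarrow> 'a) \<Rightarrow> 'a \<Rightarrow> 'a \<Rightarrow> bool" where
  "zero_divisor S mul z x \<longleftrightarrow> x \<in> S \<and> (\<exists>y\<in>S. y \<noteq> z \<and> mul x y = z)"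

locale zero_divisor_semigroup = comm_semigroup_with_zero +
  assumes all_zero_divisors: "x \<in> S \<Longrightarrow> zero_divisor S mul z x"

text \<open>As usual in \<^theory>\<open>Graph_Theory.Graph_Theory\<close>, a simple undirected graph is a loop-free
  symmetric digraph: an edge between \<open>x\<close> and \<open>y\<close> is the pair of arcs \<open>(x, y)\<close> and \<open>(y, x)\<close>.\<close>

definition zero_divisor_graph ::
    "'a set \<Rightarrow> ('a \<Rightarrow> 'a \<Rightarrow> 'a) \<Rightarrow> 'a \<Rightarrow> 'a pair_pre_digraph" where
  "zero_divisor_graph S mul z =
     \<lparr> pverts = S - {z},
       parcs = {(x, y). x \<in> S - {z} \<and> y \<in> S - {z} \<and> x \<noteq> y \<and> mul x y = z} \<rparr>"

text \<open>\<open>G\<close> is \<open>K\<^sub>n + 1\<close> with end vertex \<open>e\<close>. Like \<^const>\<open>complete_digraph\<close>, this is a property of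
  \<open>G\<close> invariant under isomorphism rather than a particular graph. The unique neighbour of \<open>e\<close> differs
  from \<open>e\<close> because a \<^const>\<open>graph\<close> has no loops, so it is one of the vertices of the \<open>K\<^sub>n\<close>.\<close>

definition complete_plus_end :: "nat \<Rightarrow> ('a, 'b) pre_digraph \<Rightarrow> 'a \<Rightarrow> bool" where
  "complete_plus_end n G e \<longleftrightarrow>
     graph G \<and> e \<in> verts G \<and> complete_digraph n (pre_digraph.del_vert G e) \<and> (\<exists>!u. e \<rightarrow>\<^bsub>G\<^esub> u)"

end

theory Submission
  imports Defs
begin

text \<open>
  Let \<open>f u = u \<cdot> x1\<close> on \<open>Mn\<close>. Since \<open>x1\<close> is idempotent, \<open>Mn1\<close> is associative if and only if
  \<open>f (f u) = f u\<close> and \<open>f (u \<cdot> v) = u \<cdot> f v\<close>. As distinct \<open>a i\<close> annihilate each other, the latter only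
  concerns the squares and the products \<open>a i \<cdot> f (a i)\<close> and \<open>f (a i) \<cdot> f (a i)\<close>. The graph is \<open>K\<^sub>n + 1\<close>
  if and only if \<open>a 1\<close> is the only nonzero element of \<open>Mn\<close> killed by \<open>f\<close>.
\<close>

lemma graph_zero_divisor_graph:
  assumes "finite S" and "\<And>x y. x \<in> S \<Longrightarrow> y \<in> S \<Longrightarrow> mul x y = mul y x"
  shows "graph (with_proj (zero_divisor_graph S mul z))"
proof -
  have "finite (parcs (zero_divisor_graph S mul z))"
    by (rule finite_subset[of _ "S \<times> S"]) (use assms(1) in \<open>auto simp: zero_divisor_graph_def\<close>)
  then interpret pair_graph "zero_divisor_graph S mul z"
    using assms
    by unfold_locales (auto simp: zero_divisor_graph_def symmetric_def sym_def)
  show ?thesis by (rule pair_graphD_graph)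
qed

text \<open>Adjacency depends only on the two endpoints and \<open>mul\<close>, so deleting a vertex
  amounts to shrinking the carrier. For \<open>Mn1\<close> and \<open>x1\<close> this gives back the
  graph of \<open>Mn\<close>.\<close>

lemma del_vert_zero_divisor_graph:
  "pre_digraph.del_vert (with_proj (zero_divisor_graph S mul z)) e
    = with_proj (zero_divisor_graph (S - {e}) mul z)"
  by (auto simp: pre_digraph.del_vert_def with_proj_def zero_divisor_graph_def)

text \<open>Once the graph without \<open>e\<close> is known to be complete, all that is left to
  decide is whether \<open>e\<close> has exactly one neighbour.\<close>

lemma complete_plus_end_zero_divisor_graph_iff:
  assumes "finite S" and "\<And>x y. x \<in> S \<Longrightarrow> y \<in> S \<Longrightarrow> mul x y = mul y x"
    and "e \<in> S" "e \<noteq> z"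
    and "complete_digraph n (with_proj (zero_divisor_graph (S - {e}) mul z))"
  shows "complete_plus_end n (with_proj (zero_divisor_graph S mul z)) e
    \<longleftrightarrow> (\<exists>!u. u \<in> S - {z, e} \<and> mul e u = z)"
proof -
  have "(e, u) \<in> parcs (zero_divisor_graph S mul z) \<longleftrightarrow> u \<in> S - {z, e} \<and> mul e u = z" for u
    using assms(3,4) by (auto simp: zero_divisor_graph_def)
  moreover have "e \<in> pverts (zero_divisor_graph S mul z)"
    using assms(3,4) by (simp add: zero_divisor_graph_def)
  ultimately show ?thesis
    using graph_zero_divisor_graph[OF assms(1,2)] assms(5)
    by (simp add: complete_plus_end_def del_vert_zero_divisor_graph)
qed

text \<open>By \<open>lin\<close> and commutativity a factor \<open>e\<close> can be moved to any
  place in a product of elements of \<open>T\<close>; \<open>proj\<close> and \<open>idem\<close>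
  absorb a repeated \<open>e\<close>. This settles every triple that contains
  \<open>e\<close>.\<close>

lemma comm_semigroup_with_zero_insert_idempotent:
  assumes T: "comm_semigroup_with_zero T mul z"
    and comm: "\<And>u. u \<in> T \<Longrightarrow> mul e u = mul u e"
    and idem: "mul e e = e"
    and closed: "\<And>u. u \<in> T \<Longrightarrow> mul u e \<in> T"
    and zero: "mul z e = z"
    and proj: "\<And>u. u \<in> T \<Longrightarrow> mul (mul u e) e = mul u e"
    and lin: "\<And>u v. u \<in> T \<Longrightarrow> v \<in> T \<Longrightarrow> mul (mul u v) e = mul u (mul v e)"
  shows "comm_semigroup_with_zero (insert e T) mul z"
proof -
  interpret T: comm_semigroup_with_zero T mul z by (fact T)
  have lin': "mul (mul u e) v = mul u (mul v e)" if "u \<in> T" "v \<in> T" for u v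
  proof -
    have "mul (mul u e) v = mul v (mul u e)" using that closed T.commute by blast
    also have "\<dots> = mul (mul v u) e" using that lin by simp
    also have "\<dots> = mul u (mul v e)" using that lin T.commute by metis
    finally show ?thesis .
  qed
  show ?thesis
  proof
    show "mul (mul x y) w = mul x (mul y w)"
      if "x \<in> insert e T" "y \<in> insert e T" "w \<in> insert e T" for x y w
      using that by (auto simp: T.assoc idem comm closed T.closed proj lin lin')
  qed (use comm idem closed zero T.closed T.commute T.zero_closed T.zero_mult in auto)
qed

theorem theorem3p2:
  fixes n :: nat
    and z x1 :: 'a
    and a :: "nat \<Rightarrow> 'a"
    and mul :: "'a \<Rightarrow> 'a \<Rightarrow> 'a" (infixl "\<cdot>" 70)
    and Mn Mn1 :: "'a set"
  assumes n: "n \<ge> 3"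
    and Mn_eq: "Mn = {z} \<union> a ` {1..n}"
    and Mn1_eq: "Mn1 = {z, x1} \<union> a ` {1..n}"
    and distinct_elements: "inj_on a {1..n}" "z \<notin> a ` {1..n}" "x1 \<notin> a ` {1..n}" "x1 \<noteq> z"
    and closed: "\<forall>x\<in>Mn1. \<forall>y\<in>Mn1. x \<cdot> y \<in> Mn1"
    and commute: "\<forall>x\<in>Mn1. \<forall>y\<in>Mn1. x \<cdot> y = y \<cdot> x"
    and zero_mult: "\<forall>x\<in>Mn1. z \<cdot> x = z"
    and a1_x1: "a 1 \<cdot> x1 = z"
    and a_a: "\<forall>i\<in>{1..n}. \<forall>j\<in>{1..n}. i \<noteq> j \<longrightarrow> a i \<cdot> a j = z"
    and Mn_semigroup: "zero_divisor_semigroup Mn mul z"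
    and Mn_graph: "complete_digraph n (with_proj (zero_divisor_graph Mn mul z))"
    and x1_idem: "x1 \<cdot> x1 = x1"
  shows "(zero_divisor_semigroup Mn1 mul z \<and>
          complete_plus_end n (with_proj (zero_divisor_graph Mn1 mul z)) x1)
    \<longleftrightarrow>
     (((\<forall>i\<in>{2..n}. a i \<cdot> x1 \<in> Mn - {a 1, z}) \<and> (\<exists>i\<in>{2..n}. a i \<cdot> x1 = a i))
    \<and> (\<forall>i\<in>{2..n}. \<forall>j\<in>{2..n}. i \<noteq> j \<and> a j = a i \<cdot> x1 \<longrightarrow>
          a j \<cdot> x1 = a j \<and> a j \<cdot> a j = z \<and> (a i \<cdot> a i = z \<or> a i \<cdot> a i = a 1))
    \<and> ((\<forall>r\<in>{2..n}. a r \<cdot> x1 = a r \<longrightarrow>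
          a r \<cdot> a r = z \<or> a r \<cdot> a r = a r \<or> (\<exists>j\<in>{2..n}. j \<noteq> r \<and> a r \<cdot> a r = a j))
       \<and> (\<forall>r\<in>{2..n}. \<forall>j\<in>{2..n}. j \<noteq> r \<and> a r \<cdot> x1 = a r \<and> a r \<cdot> a r = a j \<longrightarrow>
          a j \<cdot> x1 = a j \<and> a j \<cdot> a j = z))
    \<and> ((a 1 \<cdot> a 1 = z \<or> a 1 \<cdot> a 1 = a 1)
       \<and> (\<forall>i\<in>{2..n}. a i \<cdot> a i = a 1 \<longrightarrow> a 1 \<cdot> a 1 = z)))"
proof -
  interpret Mn: zero_divisor_semigroup Mn mul z by (fact Mn_semigroup)
  \<comment> \<open>Keeps the simplifier from turning \<open>a 1\<close> into
    \<open>a (Suc 0)\<close>.\<close>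
  note One_nat_def [simp del]
  define I where "I = {2..n}"
  have Mn1_insert: "Mn1 = insert x1 Mn" and Mn_diff: "Mn1 - {x1} = Mn"
    using Mn_eq Mn1_eq distinct_elements by auto
  have x1_Mn1: "x1 \<in> Mn1" and fin: "finite Mn1"
    using Mn_eq Mn1_eq distinct_elements by auto
  have split: "{1..n} = insert 1 I" using n by (auto simp: I_def)
  have Mn_cases: "Mn = insert z (insert (a 1) (a ` I))"
    using Mn_eq split by auto
  have z_Mn: "z \<in> Mn" and a1_Mn: "a 1 \<in> Mn" and a_Mn: "\<And>i. i \<in> I \<Longrightarrow> a i \<in> Mn"
    using Mn_cases by auto
  have a1_nz: "a 1 \<noteq> z" and a_nz: "\<And>i. i \<in> I \<Longrightarrow> a i \<noteq> z"
    using distinct_elements(2) split by force+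
  have a_ne_a1: "a i \<noteq> a 1" if "i \<in> I" for i
    using inj_onD[OF distinct_elements(1), of i 1] that n by (auto simp: I_def)
  have a1_a: "a 1 \<cdot> a i = z" "a i \<cdot> a 1 = z" if "i \<in> I" for i
    using a_a n that by (auto simp: I_def)
  have orth: "a i \<cdot> a j = z" if "i \<in> I" "j \<in> I" "i \<noteq> j" for i j
    using a_a that by (auto simp: I_def)
  have comm: "x \<cdot> y = y \<cdot> x" if "x \<in> Mn1" "y \<in> Mn1" for x y
    using commute that by blast
  have z_x1: "z \<cdot> x1 = z" using zero_mult x1_Mn1 by blast
  have u_z: "u \<cdot> z = z" if "u \<in> Mn" for u
    using Mn.commute Mn.zero_mult z_Mn that by metis
  have plus_end: "complete_plus_end n (with_proj (zero_divisor_graph Mn1 mul z)) x1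
      \<longleftrightarrow> (\<forall>i\<in>I. a i \<cdot> x1 \<noteq> z)"
  proof -
    have Mn1_diff: "Mn1 - {z, x1} = insert (a 1) (a ` I)"
      unfolding Mn1_eq split using distinct_elements split by auto
    have x1_a: "x1 \<cdot> a i = a i \<cdot> x1" if "i \<in> insert 1 I" for i
      using comm[OF x1_Mn1] Mn1_insert a1_Mn a_Mn that by auto
    \<comment> \<open>The element \<open>a 1\<close> is always a neighbour of \<open>x1\<close>, so
      uniqueness means that no \<open>a i\<close> with \<open>i \<in> I\<close> is one.\<close>
    have "u \<in> Mn1 - {z, x1} \<and> x1 \<cdot> u = z \<longleftrightarrow> u = a 1 \<or> (\<exists>i\<in>I. u = a i \<and> a i \<cdot> x1 = z)" for u
      unfolding Mn1_diff by (auto simp: x1_a a1_x1)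
    then have "(\<exists>!u. u \<in> Mn1 - {z, x1} \<and> x1 \<cdot> u = z) \<longleftrightarrow> (\<forall>i\<in>I. a i \<cdot> x1 \<noteq> z)"
      using a_ne_a1 by metis
    then show ?thesis
      using complete_plus_end_zero_divisor_graph_iff[OF fin comm x1_Mn1 distinct_elements(4)]
        Mn_graph Mn_diff by simp
  qed
  show ?thesis
    unfolding I_def[symmetric] plus_end
  proof (intro iffI; (elim conjE)?)
    assume S: "zero_divisor_semigroup Mn1 mul z" and nz: "\<forall>i\<in>I. a i \<cdot> x1 \<noteq> z"
    interpret S: zero_divisor_semigroup Mn1 mul z by (fact S)
    have assoc: "(u \<cdot> v) \<cdot> w = u \<cdot> (v \<cdot> w)" if "u \<in> Mn1" "v \<in> Mn1" "w \<in> Mn1" for u v w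
      using S.assoc that .
    have sub: "u \<in> Mn1" if "u \<in> Mn" for u using that Mn1_insert by simp
    have proj: "(u \<cdot> x1) \<cdot> x1 = u \<cdot> x1" if "u \<in> Mn" for u
      using assoc[OF sub[OF that] x1_Mn1 x1_Mn1] x1_idem by simp
    have sq_x1: "(a i \<cdot> a i) \<cdot> x1 = a i \<cdot> (a i \<cdot> x1)" if "i \<in> I" for i
      using assoc sub a_Mn that x1_Mn1 by blast
    have kernel: "u = z \<or> u = a 1" if "u \<in> Mn" "u \<cdot> x1 = z" for u
      using that Mn_cases nz by auto
    have img: "\<exists>j\<in>I. a i \<cdot> x1 = a j" if i: "i \<in> I" for i
    proof -
      \<comment> \<open>Otherwise multiplying by \<open>a j\<close> with \<open>j \<noteq> i\<close>
        would give \<open>a j \<cdot> x1 = z\<close>. Such a \<open>j\<close> exists in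
        \<open>I\<close> because \<open>n \<ge> 3\<close>.\<close>
      have "a i \<cdot> x1 \<noteq> x1"
      proof
        assume eq: "a i \<cdot> x1 = x1"
        have "2 \<in> I" "3 \<in> I" "(2::nat) \<noteq> 3" using n by (auto simp: I_def)
        then obtain j where j: "j \<in> I" "j \<noteq> i"
          by metis
        have "a j \<cdot> x1 = (a j \<cdot> a i) \<cdot> x1"
          using assoc[OF sub[OF a_Mn[OF j(1)]] sub[OF a_Mn[OF i]] x1_Mn1] eq by simp
        then show False using orth[OF j(1) i j(2)] z_x1 nz j(1) by simp
      qed
      \<comment> \<open>If equality held, applying \<open>f\<close> once more would give
        \<open>a i \<cdot> x1 = a 1 \<cdot> x1 = z\<close>.\<close>
      moreover have "a i \<cdot> x1 \<noteq> a 1" using proj[OF a_Mn[OF i]] a1_x1 nz i by metis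
      moreover have "a i \<cdot> x1 \<in> Mn1" using S.closed sub a_Mn i x1_Mn1 by blast
      ultimately show ?thesis using nz i Mn1_insert Mn_cases by auto
    qed
    have sq_Mn: "a i \<cdot> a i \<in> Mn" if "i \<in> I" for i using Mn.closed a_Mn that by blast
    have c1: "\<forall>i\<in>I. a i \<cdot> x1 \<in> Mn - {a 1, z}"
      using img a_Mn a_nz a_ne_a1 by (metis Diff_iff insert_iff singletonD)
    \<comment> \<open>Any index would do: \<open>f (a 2)\<close> is some \<open>a j\<close>, and it
      is fixed because \<open>f\<close> is idempotent.\<close>
    have "2 \<in> I" using n by (simp add: I_def)
    with img proj a_Mn have c1': "\<exists>i\<in>I. a i \<cdot> x1 = a i" by metis
    have c2: "a j \<cdot> x1 = a j \<and> a j \<cdot> a j = z \<and> (a i \<cdot> a i = z \<or> a i \<cdot> a i = a 1)"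
      if i: "i \<in> I" and j: "j \<in> I" and ij: "i \<noteq> j" and eq: "a j = a i \<cdot> x1" for i j
    proof (intro conjI)
      show fix_j: "a j \<cdot> x1 = a j" using proj[OF a_Mn[OF i]] eq by simp
      \<comment> \<open>Replace one factor \<open>a j\<close> by \<open>a i \<cdot> x1\<close>; the
        remaining product of distinct generators vanishes.\<close>
      have "a j \<cdot> a j = (a j \<cdot> a i) \<cdot> x1"
        using assoc[OF sub[OF a_Mn[OF j]] sub[OF a_Mn[OF i]] x1_Mn1] eq by simp
      then show "a j \<cdot> a j = z" using orth i j ij z_x1 by metis
      \<comment> \<open>The square lies in the kernel of \<open>f\<close>, since \<open>f\<close>
        sends it to \<open>a i \<cdot> a j = z\<close>.\<close>
      show "a i \<cdot> a i = z \<or> a i \<cdot> a i = a 1"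
        using kernel[OF sq_Mn[OF i]] sq_x1[OF i] orth[OF i j ij] eq by simp
    qed
    have c3: "a r \<cdot> a r = z \<or> a r \<cdot> a r = a r \<or> (\<exists>j\<in>I. j \<noteq> r \<and> a r \<cdot> a r = a j)"
      if r: "r \<in> I" and eq: "a r \<cdot> x1 = a r" for r
    proof -
      \<comment> \<open>As \<open>f\<close> fixes \<open>a r\<close>, it fixes its square, whereas
        it kills the nonzero \<open>a 1\<close>.\<close>
      have "a r \<cdot> a r \<noteq> a 1" using sq_x1[OF r] eq a1_x1 a1_nz by metis
      then show ?thesis using sq_Mn[OF r] Mn_cases by auto
    qed
    have c3': "a j \<cdot> x1 = a j \<and> a j \<cdot> a j = z"
      if r: "r \<in> I" and j: "j \<in> I" and jr: "j \<noteq> r" and eq: "a r \<cdot> x1 = a r" "a r \<cdot> a r = a j" for r j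
    proof
      show "a j \<cdot> x1 = a j" using sq_x1[OF r] eq by simp
      \<comment> \<open>Expand only one factor \<open>a j\<close> as the square of
        \<open>a r\<close>, so that orthogonality applies; \<open>c4'\<close> below uses the same
        device.\<close>
      have "a j \<cdot> a j = (a j \<cdot> a r) \<cdot> a r"
        using Mn.assoc a_Mn r j eq by metis
      then show "a j \<cdot> a j = z" using orth[OF j r jr] Mn.zero_mult a_Mn r by simp
    qed
    have "(a 1 \<cdot> a 1) \<cdot> x1 = z"
      using assoc[OF sub[OF a1_Mn] sub[OF a1_Mn] x1_Mn1] a1_x1 u_z a1_Mn by simp
    then have c4: "a 1 \<cdot> a 1 = z \<or> a 1 \<cdot> a 1 = a 1"
      using kernel Mn.closed a1_Mn by blast
    have c4': "a 1 \<cdot> a 1 = z" if i: "i \<in> I" and eq: "a i \<cdot> a i = a 1" for i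
    proof -
      have "a 1 \<cdot> a 1 = (a 1 \<cdot> a i) \<cdot> a i" using Mn.assoc a_Mn i a1_Mn eq by metis
      then show ?thesis using a1_a i Mn.zero_mult a_Mn by simp
    qed
    show "((\<forall>i\<in>I. a i \<cdot> x1 \<in> Mn - {a 1, z}) \<and> (\<exists>i\<in>I. a i \<cdot> x1 = a i))
      \<and> (\<forall>i\<in>I. \<forall>j\<in>I. i \<noteq> j \<and> a j = a i \<cdot> x1 \<longrightarrow>
            a j \<cdot> x1 = a j \<and> a j \<cdot> a j = z \<and> (a i \<cdot> a i = z \<or> a i \<cdot> a i = a 1))
      \<and> ((\<forall>r\<in>I. a r \<cdot> x1 = a r \<longrightarrow>
            a r \<cdot> a r = z \<or> a r \<cdot> a r = a r \<or> (\<exists>j\<in>I. j \<noteq> r \<and> a r \<cdot> a r = a j))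
         \<and> (\<forall>r\<in>I. \<forall>j\<in>I. j \<noteq> r \<and> a r \<cdot> x1 = a r \<and> a r \<cdot> a r = a j \<longrightarrow>
            a j \<cdot> x1 = a j \<and> a j \<cdot> a j = z))
      \<and> ((a 1 \<cdot> a 1 = z \<or> a 1 \<cdot> a 1 = a 1)
         \<and> (\<forall>i\<in>I. a i \<cdot> a i = a 1 \<longrightarrow> a 1 \<cdot> a 1 = z))"
      by (intro conjI ballI impI; (elim conjE)?)
        (use c1 c1' c2 c3 c3' c4 c4' in \<open>blast+\<close>)
  next
    assume c1: "\<forall>i\<in>I. a i \<cdot> x1 \<in> Mn - {a 1, z}"
      and c2: "\<forall>i\<in>I. \<forall>j\<in>I. i \<noteq> j \<and> a j = a i \<cdot> x1 \<longrightarrow>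
          a j \<cdot> x1 = a j \<and> a j \<cdot> a j = z \<and> (a i \<cdot> a i = z \<or> a i \<cdot> a i = a 1)"
      and c3: "\<forall>r\<in>I. a r \<cdot> x1 = a r \<longrightarrow>
          a r \<cdot> a r = z \<or> a r \<cdot> a r = a r \<or> (\<exists>j\<in>I. j \<noteq> r \<and> a r \<cdot> a r = a j)"
      and c3': "\<forall>r\<in>I. \<forall>j\<in>I. j \<noteq> r \<and> a r \<cdot> x1 = a r \<and> a r \<cdot> a r = a j \<longrightarrow>
          a j \<cdot> x1 = a j \<and> a j \<cdot> a j = z"
      and c4: "a 1 \<cdot> a 1 = z \<or> a 1 \<cdot> a 1 = a 1"
    have img: "\<exists>j\<in>I. a i \<cdot> x1 = a j" if "i \<in> I" for i
      using c1 that Mn_cases by auto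
    have "comm_semigroup_with_zero (insert x1 Mn) mul z"
    proof (rule comm_semigroup_with_zero_insert_idempotent)
      show "comm_semigroup_with_zero Mn mul z" by unfold_locales
      show "x1 \<cdot> u = u \<cdot> x1" if "u \<in> Mn" for u
        using comm x1_Mn1 that Mn1_insert by simp
      show "x1 \<cdot> x1 = x1" "z \<cdot> x1 = z" by (fact x1_idem, fact z_x1)
      show "u \<cdot> x1 \<in> Mn" if "u \<in> Mn" for u
        using that Mn_cases c1 z_x1 a1_x1 by auto
      \<comment> \<open>Either \<open>f\<close> fixes \<open>a i\<close>, or it moves
        \<open>a i\<close> to another generator, which is fixed by \<open>c2\<close>.\<close>
      have proj: "(a i \<cdot> x1) \<cdot> x1 = a i \<cdot> x1" if i: "i \<in> I" for i
        using img[OF i] c2 i by metis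
      then show "(u \<cdot> x1) \<cdot> x1 = u \<cdot> x1" if "u \<in> Mn" for u
        using that Mn_cases z_x1 a1_x1 by auto
      have lin: "(u \<cdot> a k) \<cdot> x1 = u \<cdot> (a k \<cdot> x1)" if u: "u \<in> Mn" and k: "k \<in> I" for u k
      proof -
        obtain j where j: "j \<in> I" "a k \<cdot> x1 = a j" using img[OF k] by blast
        consider "u = z" | "u = a 1" | i where "i \<in> I" "u = a i" using u Mn_cases by auto
        then show ?thesis
        proof cases
          case 1
          then show ?thesis using j Mn.zero_mult a_Mn k z_x1 by simp
        next
          case 2
          then show ?thesis using j a1_a k z_x1 by simp
        next
          case i: 3
          show ?thesis
          proof (cases "j = k")
            case True
            then have fix_k: "a k \<cdot> x1 = a k" using j by simp
            \<comment> \<open>By \<open>c3\<close> the square is \<open>z\<close>,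
              \<open>a k\<close> itself or another generator, and \<open>c3'\<close> makes that last
              one a fixed point too.\<close>
            have "(a k \<cdot> a k) \<cdot> x1 = a k \<cdot> a k"
              using c3 c3' k fix_k z_x1 by metis
            then show ?thesis using i orth k fix_k z_x1 by (cases "i = k") auto
          next
            case False
            \<comment> \<open>When \<open>f\<close> moves \<open>a k\<close>, both sides vanish:
              \<open>f\<close> kills the possible squares \<open>z\<close> and \<open>a 1\<close> of
              \<open>a k\<close>, and \<open>a i \<cdot> a j\<close> is zero even for
              \<open>i = j\<close>.\<close>
            then have sq: "a j \<cdot> a j = z" "a k \<cdot> a k = z \<or> a k \<cdot> a k = a 1"
              using c2 k j by metis+
            have "(a i \<cdot> a k) \<cdot> x1 = z"
              using sq(2) i(1) k orth z_x1 a1_x1 by (cases "i = k") auto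
            moreover have "a i \<cdot> a j = z"
              using sq(1) i(1) j(1) orth by (cases "i = j") auto
            ultimately show ?thesis using i j by simp
          qed
        qed
      qed
      \<comment> \<open>The case of right factor \<open>a 1\<close>, where
        \<open>u \<cdot> (a 1 \<cdot> x1)\<close> is zero. By \<open>c4\<close> the product
        \<open>u \<cdot> a 1\<close> is always \<open>z\<close> or \<open>a 1\<close>, hence killed
        by \<open>f\<close>.\<close>
      have lin1: "(u \<cdot> a 1) \<cdot> x1 = z" if "u \<in> Mn" for u
        using that Mn_cases Mn.zero_mult a1_Mn a1_a c4 z_x1 a1_x1 by auto
      show "(u \<cdot> v) \<cdot> x1 = u \<cdot> (v \<cdot> x1)" if "u \<in> Mn" "v \<in> Mn" for u v
        using that(2) unfolding Mn_cases
        using lin[OF that(1)] lin1[OF that(1)] u_z[OF that(1)] z_x1 a1_x1 by auto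
    qed
    then interpret S: comm_semigroup_with_zero Mn1 mul z using Mn1_insert by simp
    \<comment> \<open>The element \<open>x1\<close> is annihilated by \<open>a 1\<close>; every
      other element keeps its annihilator from \<open>Mn\<close>.\<close>
    have "zero_divisor Mn1 mul z x" if "x \<in> Mn1" for x
    proof (cases "x = x1")
      case True
      then show ?thesis
        using x1_Mn1 a1_x1 a1_nz a1_Mn Mn1_insert comm unfolding zero_divisor_def by (metis insertCI)
    next
      case False
      then show ?thesis
        using Mn.all_zero_divisors[of x] that Mn1_insert unfolding zero_divisor_def by auto
    qed
    then have "zero_divisor_semigroup Mn1 mul z" by unfold_locales
    then show "zero_divisor_semigroup Mn1 mul z \<and> (\<forall>i\<in>I. a i \<cdot> x1 \<noteq> z)"
      using c1 by blast
  qed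
qed

end
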